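(* For every $n,d\in\mathbb{N}$ with $d\in\{1,\ldots,n\}$ and every function $f:\{-1,1\}^n\to\mathbb{C}$ of degree at most $d$, we have $$\|f\|_{L_2(\{-1,1\}^n;\mathbb{C})}\leq(2.69076)^d\,\|f\|_{L_1(\{-1,1\}^n;\mathbb{C})}.$$
   Context: $\mathbb{N}=\{1,2,\ldots\}$. For $p\in[1,\infty)$, $\|f\|_{L_p(\{-1,1\}^n;\mathbb{C})}=\big(2^{-n}\sum_{\varepsilon\in\{-1,1\}^n}|f(\varepsilon)|^p\big)^{1/p}$. For $A\subseteq\{1,\ldots,n\}$, the Walsh function is $w_A(\varepsilon)=\prod_{i\in A}\varepsilon_i$. Every $f:\{-1,1\}^n\to\mathbb{C}$ has the expansion $f=\sum_{A}\widehat f(A)w_A$ with $\widehat f(A)=2^{-n}\sum_{\delta\in\{-1,1\}^n}f(\delta)w_A(\delta)$. A function $f$ has degree at most $d$ if $\widehat f(A)=0$ whenever $|A|>d$. *)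

theory Defs
  imports "HOL-Analysis.Analysis"
begin

(* Points of the cube are extensional functions on {1..n}, so that the cube has exactly
   2 ^ n elements; a function on the cube is a total function of which only the values
   on the cube are ever used. *)
definition cube :: "nat \<Rightarrow> (nat \<Rightarrow> real) set" where
  "cube n = {1..n} \<rightarrow>\<^sub>E {-1, 1}"

definition Lp_norm :: "nat \<Rightarrow> real \<Rightarrow> ((nat \<Rightarrow> real) \<Rightarrow> complex) \<Rightarrow> real" where
  "Lp_norm n p f = ((\<Sum>\<epsilon>\<in>cube n. cmod (f \<epsilon>) powr p) / 2 ^ n) powr (1 / p)"

definition walsh :: "nat set \<Rightarrow> (nat \<Rightarrow> real) \<Rightarrow> real" where
  "walsh A \<epsilon> = (\<Prod>i\<in>A. \<epsilon> i)"

definition fourier_coeff :: "nat \<Rightarrow> ((nat \<Rightarrow> real) \<Rightarrow> complex) \<Rightarrow> nat set \<Rightarrow> complex" where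
  "fourier_coeff n f A = (\<Sum>\<delta>\<in>cube n. f \<delta> * of_real (walsh A \<delta>)) / 2 ^ n"

definition degree_at_most :: "nat \<Rightarrow> ((nat \<Rightarrow> real) \<Rightarrow> complex) \<Rightarrow> nat \<Rightarrow> bool" where
  "degree_at_most n f d \<longleftrightarrow> (\<forall>A\<subseteq>{1..n}. card A > d \<longrightarrow> fourier_coeff n f A = 0)"

end

theory Submission
  imports Defs "HOL-Complex_Analysis.Conformal_Mappings"
begin

text \<open>
  The noise operator \<open>T\<^sub>w\<close> multiplies the Walsh coefficient of \<open>A\<close> by \<open>w\<close> to the power
  \<open>card A\<close>. For real \<open>w\<close>, hypercontractivity says that \<open>T\<^sub>w\<close> contracts \<open>L\<^sub>4\<^sub>/\<^sub>3\<close> into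
  \<open>L\<^sub>4\<close> when \<open>\<bar>w\<bar> \<le> 1/3\<close>, and for \<open>f\<close> of degree at most \<open>d\<close> this bounds the \<open>L\<^sub>4\<close>-norm
  by \<open>3\<^sup>d\<close> times the \<open>L\<^sub>4\<^sub>/\<^sub>3\<close>-norm. By log-convexity of the norms in the reciprocal of the
  exponent, the same constant then compares \<open>L\<^sub>2\<close> with \<open>L\<^sub>1\<close>.

  The base \<open>3\<close> improves because \<open>T\<^sub>w\<close> is still a contraction for complex \<open>w\<close> on an ellipse with
  real semi-axis \<open>1/3\<close> and the larger imaginary semi-axis \<open>\<surd>2 / 3\<close> (lemma \<open>hypercontractive\<close>).
  This is a special case of Weissler's complex hypercontractivity; it rests on a two-point
  inequality (lemma \<open>two_point\<close>), which is tensorised by Minkowski's inequality. For fixed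
  \<open>g\<close>, the mean of \<open>T\<^sub>w f\<close> times \<open>g\<close> is a polynomial of degree at most \<open>d\<close> in \<open>w\<close>.
  A polynomial bounded by \<open>B\<close> on the ellipse is bounded at \<open>1\<close> by \<open>\<kappa>\<^sup>d B\<close>, where \<open>\<kappa>\<close> comes
  from the conformal map of the exterior of the ellipse (lemma \<open>ellipse_extrapolation\<close>). Here
  \<open>\<kappa> = (\<surd>2 - 1) / (\<surd>10 - 3)\<close>, which is less than \<open>2.5526\<close>. Taking for \<open>g\<close> the function
  dual to \<open>f\<close> gives the comparison of \<open>L\<^sub>4\<close> and \<open>L\<^sub>4\<^sub>/\<^sub>3\<close> (lemma \<open>L4_le_L43\<close>), and two
  applications of Hoelder's inequality finish the proof.
\<close>

section \<open>The two-point inequality\<close>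

lemma powr_power_real:
  fixes x :: real
  assumes "0 \<le> x" "0 < k"
  shows "(x powr a) ^ k = x powr (real k * a)"
  using assms by (cases "x = 0") (simp_all add: powr_powr mult.commute flip: powr_realpow)

lemma power_powr_real:
  fixes x :: real
  assumes "0 \<le> x" "0 < k"
  shows "(x ^ k) powr a = x powr (real k * a)"
  using assms by (cases "x = 0") (simp_all add: powr_powr flip: powr_realpow)

text \<open>
  The two-point inequality in real coordinates. Here \<open>u\<close> and \<open>v\<close> are the cube roots of
  \<open>\<bar>a + b\<bar>\<close> and \<open>\<bar>a - b\<bar>\<close>, which makes the \<open>4/3\<close>-th powers polynomial, while
  \<open>p = \<bar>a\<bar>\<^sup>2\<close>, \<open>q = \<bar>b\<bar>\<^sup>2\<close>, \<open>D + \<i> F\<close> is \<open>a\<close> times the conjugate of \<open>b\<close>,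
  and \<open>w = x + \<i> y\<close>.

  Put \<open>\<rho> = \<bar>w\<bar>\<^sup>2\<close>. Since \<open>p q = D\<^sup>2 + F\<^sup>2\<close>, the square \<open>(p + \<rho> q)\<^sup>2\<close> equals
  \<open>(p + q)\<^sup>2\<close> minus the two nonnegative terms \<open>2 (1 - \<rho>) (D\<^sup>2 + F\<^sup>2)\<close> and
  \<open>(1 - \<rho>\<^sup>2) q\<^sup>2\<close>. The right-hand side falls short of \<open>(p + q)\<^sup>2\<close> by exactly
  \<open>4/3 D\<^sup>2\<close> plus a term of fourth order in \<open>u - v\<close>. Step \<open>A\<close> pays for the quadratic
  terms with the first gain; there the shape of the ellipse decides. Step \<open>B\<close> pays for the
  fourth-order term with the second gain, because a small \<open>q\<close> forces \<open>u\<close> and \<open>v\<close>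
  to be close.
\<close>

lemma two_point_real:
  fixes p q D F x y u v :: real
  assumes pq: "p * q = D\<^sup>2 + F\<^sup>2"
    and u6: "u ^ 6 = p + q + 2 * D" and v6: "v ^ 6 = p + q - 2 * D"
    and uv: "0 \<le> u" "0 \<le> v"
    and q: "(u ^ 3 - v ^ 3)\<^sup>2 / 4 \<le> q"
    and ell: "9 * x\<^sup>2 + 9 / 2 * y\<^sup>2 = 1"
  shows "(p + (x\<^sup>2 + y\<^sup>2) * q)\<^sup>2 + 4 * (x * D + y * F)\<^sup>2 \<le> ((u ^ 4 + v ^ 4) / 2) ^ 3"
proof -
  define \<rho> where "\<rho> = x\<^sup>2 + y\<^sup>2"
  define e \<sigma> where "e = u * v" and "\<sigma> = u\<^sup>2 + v\<^sup>2"
  have \<rho>: "0 \<le> \<rho>" "\<rho> \<le> 2/9"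
    using ell zero_le_power2[of x] unfolding \<rho>_def by (simp, linarith)
  have \<rho>2: "14/15 \<le> 1 - \<rho>\<^sup>2"
    using power_mono[OF \<rho>(2) \<rho>(1), of 2] by (simp add: power2_eq_square)
  have A: "4 * (x * D + y * F)\<^sup>2 + 4/3 * D\<^sup>2 \<le> 2 * (1 - \<rho>) * (D\<^sup>2 + F\<^sup>2)"
  proof -
    have "2 * (1 - \<rho>) * (D\<^sup>2 + F\<^sup>2) - (4 * (x * D + y * F)\<^sup>2 + 4/3 * D\<^sup>2)
        = (y * D - 4 * x * F)\<^sup>2 + 3 * y\<^sup>2 * F\<^sup>2
          + (2/3 * D\<^sup>2 + 2 * F\<^sup>2) * (1 - 9 * x\<^sup>2 - 9/2 * y\<^sup>2)"
      unfolding \<rho>_def by (simp add: power2_eq_square algebra_simps)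
    then show ?thesis using ell
      by (smt (verit, best) mult_eq_0_iff zero_le_power2 zero_le_mult_iff)
  qed
  have e: "0 \<le> e" "2 * e \<le> \<sigma>" "0 \<le> \<sigma>"
    using uv sum_squares_bound[of u v] by (auto simp: e_def \<sigma>_def)
  (* With q replaced by its lower bound, both sides contain the factor (u - v)^4. What remains
     is an inequality between sigma and e with sigma >= 2 e, where the substitution
     sigma = r + 2 e makes every coefficient of the difference positive. *)
  have B: "(\<sigma>\<^sup>2 - 4 * e\<^sup>2)\<^sup>2 * (\<sigma>\<^sup>2 + 2 * e\<^sup>2) / 24 \<le> (1 - \<rho>\<^sup>2) * q\<^sup>2"
  proof -
    have "(\<sigma> + 2 * e)\<^sup>2 * (\<sigma>\<^sup>2 + 2 * e\<^sup>2) / 24 \<le> 14/15 * ((\<sigma> + e)^4 / 16)"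
    proof -
      define r where "r = \<sigma> - 2 * e"
      have "r \<ge> 0" using e by (simp add: r_def)
      moreover have "\<sigma> = r + 2 * e" by (simp add: r_def)
      ultimately have "14/15 * ((\<sigma> + e)^4 / 16) - (\<sigma> + 2 * e)\<^sup>2 * (\<sigma>\<^sup>2 + 2 * e\<^sup>2) / 24
          = r^4 / 60 + e * r^3 / 5 + 9/10 * e\<^sup>2 * r\<^sup>2 + 49/30 * e^3 * r + 29/40 * e^4"
        by (simp add: field_simps power2_eq_square power3_eq_cube power4_eq_xxxx)
      also have "\<dots> \<ge> 0" using \<open>r \<ge> 0\<close> e(1) by simp
      finally show ?thesis by simp
    qed
    then have "(u - v)^4 * ((\<sigma> + 2 * e)\<^sup>2 * (\<sigma>\<^sup>2 + 2 * e\<^sup>2) / 24)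
        \<le> (u - v)^4 * (14/15 * ((\<sigma> + e)^4 / 16))"
      by (intro mult_left_mono) auto
    also have "\<dots> = 14/15 * (((u^3 - v^3)\<^sup>2 / 4)\<^sup>2)"
    proof -
      have "u^3 - v^3 = (u - v) * (\<sigma> + e)" unfolding e_def \<sigma>_def by algebra
      then show ?thesis by (simp add: power_mult_distrib power_divide)
    qed
    also have "\<dots> \<le> (1 - \<rho>\<^sup>2) * q\<^sup>2"
      using \<rho>2 q by (intro mult_mono power_mono) auto
    also have "(u - v)^4 * ((\<sigma> + 2 * e)\<^sup>2 * (\<sigma>\<^sup>2 + 2 * e\<^sup>2) / 24)
        = (\<sigma>\<^sup>2 - 4 * e\<^sup>2)\<^sup>2 * (\<sigma>\<^sup>2 + 2 * e\<^sup>2) / 24"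
    proof -
      have "\<sigma>\<^sup>2 - 4 * e\<^sup>2 = (u - v)\<^sup>2 * (\<sigma> + 2 * e)" unfolding e_def \<sigma>_def by algebra
      then show ?thesis by (simp add: power_mult_distrib)
    qed
    finally show ?thesis .
  qed
  (* The shortfall of the right-hand side, expressed in the symmetric functions of u^2, v^2. *)
  have C: "(p + q)\<^sup>2 - ((u ^ 4 + v ^ 4) / 2) ^ 3
      = 4/3 * D\<^sup>2 + (\<sigma>\<^sup>2 - 4 * e\<^sup>2)\<^sup>2 * (\<sigma>\<^sup>2 + 2 * e\<^sup>2) / 24"
  proof -
    have 1: "u ^ 4 + v ^ 4 = \<sigma>\<^sup>2 - 2 * e\<^sup>2" and "u ^ 6 + v ^ 6 = \<sigma> * (\<sigma>\<^sup>2 - 3 * e\<^sup>2)"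
      and "u ^ 6 - v ^ 6 = (u\<^sup>2 - v\<^sup>2) * (\<sigma>\<^sup>2 - e\<^sup>2)" and 4: "(u\<^sup>2 - v\<^sup>2)\<^sup>2 = \<sigma>\<^sup>2 - 4 * e\<^sup>2"
      unfolding e_def \<sigma>_def by algebra+
    then have 2: "p + q = \<sigma> * (\<sigma>\<^sup>2 - 3 * e\<^sup>2) / 2" and D: "D = (u\<^sup>2 - v\<^sup>2) * (\<sigma>\<^sup>2 - e\<^sup>2) / 4"
      using u6 v6 by auto
    have 3: "D\<^sup>2 = (\<sigma>\<^sup>2 - 4 * e\<^sup>2) * (\<sigma>\<^sup>2 - e\<^sup>2)\<^sup>2 / 16"
      unfolding D by (simp add: power_mult_distrib power_divide 4)
    show ?thesis
      unfolding 1 2 3 by (simp add: field_simps power2_eq_square power3_eq_cube)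
  qed
  have "(p + \<rho> * q)\<^sup>2 = (p + q)\<^sup>2 - 2 * (1 - \<rho>) * (D\<^sup>2 + F\<^sup>2) - (1 - \<rho>\<^sup>2) * q\<^sup>2"
    unfolding pq[symmetric] by algebra
  with A B C show ?thesis unfolding \<rho>_def by linarith
qed

text \<open>
  For two points, the operator multiplying the linear coefficient by \<open>w\<close> is a contraction
  from \<open>L\<^sub>4\<^sub>/\<^sub>3\<close> to \<open>L\<^sub>4\<close>. For real \<open>w\<close> this forces \<open>\<bar>w\<bar> \<le> 1/3\<close>; the point is that
  imaginary \<open>w\<close> may be larger, here up to \<open>\<surd>2 / 3\<close>.
\<close>

lemma two_point:
  fixes a b w :: complex
  assumes ell: "9 * (Re w)\<^sup>2 + 9 / 2 * (Im w)\<^sup>2 = 1"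
  shows "(cmod (a + w * b) ^ 4 + cmod (a - w * b) ^ 4) / 2
     \<le> ((cmod (a + b) powr (4/3) + cmod (a - b) powr (4/3)) / 2) ^ 3"
proof -
  define u v where "u = cmod (a + b) powr (1/3)" and "v = cmod (a - b) powr (1/3)"
  define p q where "p = (cmod a)\<^sup>2" and "q = (cmod b)\<^sup>2"
  define D F where "D = Re (a * cnj b)" and "F = Im (a * cnj b)"
  have uv: "0 \<le> u" "0 \<le> v" by (auto simp: u_def v_def)
  have pow: "u ^ k = cmod (a + b) powr (k/3)" "v ^ k = cmod (a - b) powr (k/3)" if "k > 0" for k :: nat
    using that by (simp_all add: u_def v_def powr_power_real)
  have u3: "u ^ 3 = cmod (a + b)" "v ^ 3 = cmod (a - b)"
    by (simp_all add: pow)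
  have "u ^ 6 = (cmod (a + b))\<^sup>2" "v ^ 6 = (cmod (a - b))\<^sup>2"
    unfolding u3[symmetric] by (simp_all flip: power_mult)
  then have u6: "u ^ 6 = p + q + 2 * D" and v6: "v ^ 6 = p + q - 2 * D"
    unfolding p_def q_def D_def cmod_power2 by (simp_all add: power2_eq_square algebra_simps)
  have pq: "p * q = D\<^sup>2 + F\<^sup>2"
    unfolding p_def q_def D_def F_def cmod_power2 by (simp add: power2_eq_square algebra_simps)
  have "\<bar>cmod (a + b) - cmod (a - b)\<bar> \<le> cmod ((a + b) - (a - b))"
    by (rule norm_triangle_ineq3)
  then have "\<bar>u^3 - v^3\<bar> \<le> 2 * cmod b" using norm_mult[of 2 b] by (simp add: u3)
  then have "(u^3 - v^3)\<^sup>2 \<le> (2 * cmod b)\<^sup>2"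
    using power_mono[of "\<bar>u^3 - v^3\<bar>" "2 * cmod b" 2] by simp
  then have qb: "(u^3 - v^3)\<^sup>2 / 4 \<le> q" by (simp add: q_def power_mult_distrib)
  define P L where "P = p + ((Re w)\<^sup>2 + (Im w)\<^sup>2) * q" and "L = Re w * D + Im w * F"
  have "(cmod (a + w * b))\<^sup>2 = P + 2 * L" "(cmod (a - w * b))\<^sup>2 = P - 2 * L"
    unfolding P_def L_def p_def q_def D_def F_def cmod_power2 by (simp_all add: power2_eq_square algebra_simps)
  moreover have "z ^ 4 = (z\<^sup>2)\<^sup>2" for z :: real by simp
  ultimately have "cmod (a + w * b) ^ 4 = (P + 2 * L)\<^sup>2" "cmod (a - w * b) ^ 4 = (P - 2 * L)\<^sup>2"
    by metis+
  then have "(cmod (a + w * b) ^ 4 + cmod (a - w * b) ^ 4) / 2 = P\<^sup>2 + 4 * L\<^sup>2"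
    by (simp add: power2_eq_square algebra_simps)
  also have "\<dots> \<le> ((u ^ 4 + v ^ 4) / 2) ^ 3"
    unfolding P_def L_def by (rule two_point_real[OF pq u6 v6 uv qb ell])
  finally show ?thesis by (simp add: pow)
qed

section \<open>Walsh polynomials and the noise operator\<close>

lemma finite_cube: "finite (cube n)"
  by (auto simp: cube_def intro!: finite_PiE)

lemma sum_cube_Suc:
  fixes g :: "(nat \<Rightarrow> real) \<Rightarrow> 'a::comm_monoid_add"
  shows "(\<Sum>\<epsilon>\<in>cube (Suc n). g \<epsilon>) = (\<Sum>\<epsilon>\<in>cube n. g (\<epsilon>(Suc n := 1)) + g (\<epsilon>(Suc n := -1)))"
proof -
  have ins: "{1..Suc n} = insert (Suc n) {1..n}" by auto
  have inj: "inj_on (\<lambda>(y, g). g(Suc n := y)) ({-1, 1 :: real} \<times> cube n)"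
    unfolding cube_def by (rule inj_combinator) auto
  have "(\<Sum>\<epsilon>\<in>cube (Suc n). g \<epsilon>) = (\<Sum>(y, \<epsilon>)\<in>{-1, 1 :: real} \<times> cube n. g (\<epsilon>(Suc n := y)))"
    using inj unfolding cube_def ins PiE_insert_eq
    by (subst sum.reindex) (auto simp: case_prod_unfold)
  also have "\<dots> = (\<Sum>\<epsilon>\<in>cube n. g (\<epsilon>(Suc n := 1)) + g (\<epsilon>(Suc n := -1)))"
    by (simp flip: sum.cartesian_product add: sum.distrib add.commute)
  finally show ?thesis .
qed

lemma walsh_upd:
  assumes "A \<subseteq> {1..n}"
  shows "walsh A (\<epsilon>(Suc n := y)) = walsh A \<epsilon>"
    and "walsh (insert (Suc n) A) (\<epsilon>(Suc n := y)) = y * walsh A \<epsilon>"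
proof -
  have "Suc n \<notin> A" using assms by auto
  moreover from this have "(\<Prod>i\<in>A. (\<epsilon>(Suc n := y)) i) = (\<Prod>i\<in>A. \<epsilon> i)"
    by (intro prod.cong) auto
  moreover have "finite A" using assms finite_subset by blast
  ultimately show "walsh A (\<epsilon>(Suc n := y)) = walsh A \<epsilon>"
    "walsh (insert (Suc n) A) (\<epsilon>(Suc n := y)) = y * walsh A \<epsilon>"
    by (simp_all add: walsh_def)
qed

definition walsh_poly :: "nat \<Rightarrow> (nat set \<Rightarrow> complex) \<Rightarrow> (nat \<Rightarrow> real) \<Rightarrow> complex" where
  "walsh_poly n c \<epsilon> = (\<Sum>A\<in>Pow {1..n}. c A * of_real (walsh A \<epsilon>))"

text \<open>
  On coefficients, the noise operator is diagonal; letting its parameter be complex is what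
  turns a statement about the degree into one about polynomials in \<open>w\<close>.
\<close>

definition noise :: "complex \<Rightarrow> (nat set \<Rightarrow> complex) \<Rightarrow> nat set \<Rightarrow> complex" where
  "noise w c A = w ^ card A * c A"

text \<open>
  Splitting off the last coordinate writes a Walsh polynomial as \<open>F + y G\<close> with \<open>F\<close> and
  \<open>G\<close> on the smaller cube, which is the form the two-point inequality applies to.
\<close>

lemma walsh_poly_Suc:
  "walsh_poly (Suc n) c (\<epsilon>(Suc n := y))
    = walsh_poly n c \<epsilon> + of_real y * walsh_poly n (\<lambda>A. c (insert (Suc n) A)) \<epsilon>"
proof -
  have ins: "{1..Suc n} = insert (Suc n) {1..n}" by auto
  have inj: "inj_on (insert (Suc n)) (Pow {1..n})"
  proof (rule inj_onI)
    fix A B assume "A \<in> Pow {1..n}" "B \<in> Pow {1..n}" and eq: "insert (Suc n) A = insert (Suc n) B"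
    then have "Suc n \<notin> A" "Suc n \<notin> B" by auto
    with eq show "A = B" using insert_ident[of "Suc n" A B] by simp
  qed
  have "walsh_poly (Suc n) c (\<epsilon>(Suc n := y))
     = (\<Sum>A\<in>Pow {1..n}. c A * of_real (walsh A (\<epsilon>(Suc n := y))))
     + (\<Sum>A\<in>insert (Suc n) ` Pow {1..n}. c A * of_real (walsh A (\<epsilon>(Suc n := y))))"
    unfolding walsh_poly_def ins Pow_insert by (rule sum.union_disjoint) auto
  also have "\<dots> = (\<Sum>A\<in>Pow {1..n}. c A * of_real (walsh A \<epsilon>))
     + (\<Sum>A\<in>Pow {1..n}. c (insert (Suc n) A) * (of_real y * of_real (walsh A \<epsilon>)))"
    using inj by (simp add: sum.reindex walsh_upd)
  finally show ?thesis by (simp add: walsh_poly_def sum_distrib_left mult_ac)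
qed

lemma walsh_poly_noise_Suc:
  "walsh_poly (Suc n) (noise w c) (\<epsilon>(Suc n := y))
    = walsh_poly n (noise w c) \<epsilon> + of_real y * (w * walsh_poly n (noise w (\<lambda>A. c (insert (Suc n) A))) \<epsilon>)"
proof -
  have "card (insert (Suc n) A) = Suc (card A)" if "A \<subseteq> {1..n}" for A
    using that finite_subset[OF that] by (subst card_insert_disjoint) auto
  then have "walsh_poly n (\<lambda>A. noise w c (insert (Suc n) A)) \<epsilon>
      = w * walsh_poly n (noise w (\<lambda>A. c (insert (Suc n) A))) \<epsilon>"
    by (simp add: walsh_poly_def noise_def sum_distrib_left mult_ac)
  then show ?thesis by (simp add: walsh_poly_Suc)
qed

lemma walsh_poly_linear:
  "walsh_poly n (noise w (\<lambda>A. c A + y * d A)) \<epsilon> = walsh_poly n (noise w c) \<epsilon> + y * walsh_poly n (noise w d) \<epsilon>"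
  by (simp add: walsh_poly_def noise_def sum_distrib_left algebra_simps flip: sum.distrib)

text \<open>
  Summed over all index sets, the Walsh functions at \<open>\<delta>\<close> and \<open>\<epsilon>\<close> give the product of
  the factors \<open>\<delta>\<^sub>i \<epsilon>\<^sub>i + 1\<close>, which is a multiple of the indicator of \<open>\<delta> = \<epsilon>\<close>.
\<close>

lemma fourier_inversion:
  assumes "\<epsilon> \<in> cube n"
  shows "walsh_poly n (fourier_coeff n f) \<epsilon> = f \<epsilon>"
proof -
  have kernel: "(\<Sum>A\<in>Pow {1..n}. walsh A \<delta> * walsh A \<epsilon>) = (if \<delta> = \<epsilon> then 2 ^ n else 0)"
    if \<delta>: "\<delta> \<in> cube n" for \<delta>
  proof -
    have "(\<Sum>A\<in>Pow {1..n}. walsh A \<delta> * walsh A \<epsilon>) = (\<Prod>i\<in>{1..n}. \<delta> i * \<epsilon> i + 1)"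
      by (simp add: walsh_def prod_add flip: prod.distrib)
    also have "\<dots> = (if \<delta> = \<epsilon> then 2 ^ n else 0)"
    proof (cases "\<delta> = \<epsilon>")
      case True
      have "\<delta> i * \<epsilon> i + 1 = 2" if "i \<in> {1..n}" for i
        using PiE_mem[OF assms[unfolded cube_def] that] True by auto
      then show ?thesis using True by simp
    next
      case False
      then obtain i where i: "i \<in> {1..n}" "\<delta> i \<noteq> \<epsilon> i"
        using PiE_ext[OF \<delta>[unfolded cube_def] assms[unfolded cube_def]] by blast
      moreover have "\<delta> i \<in> {-1, 1}" "\<epsilon> i \<in> {-1, 1}"
        using PiE_mem[OF \<delta>[unfolded cube_def] i(1)] PiE_mem[OF assms[unfolded cube_def] i(1)] .
      ultimately have "\<delta> i * \<epsilon> i + 1 = 0" by auto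
      then show ?thesis using False i by (auto intro!: prod_zero)
    qed
    finally show ?thesis .
  qed
  have "walsh_poly n (fourier_coeff n f) \<epsilon>
     = (\<Sum>A\<in>Pow {1..n}. \<Sum>\<delta>\<in>cube n. f \<delta> * of_real (walsh A \<delta> * walsh A \<epsilon>)) / 2 ^ n"
    by (simp add: walsh_poly_def fourier_coeff_def sum_distrib_right sum_divide_distrib mult.assoc)
  also have "\<dots> = (\<Sum>\<delta>\<in>cube n. f \<delta> * of_real (\<Sum>A\<in>Pow {1..n}. walsh A \<delta> * walsh A \<epsilon>)) / 2 ^ n"
    by (subst sum.swap) (simp add: sum_distrib_left)
  also have "\<dots> = (\<Sum>\<delta>\<in>cube n. if \<delta> = \<epsilon> then f \<delta> * 2 ^ n else 0) / 2 ^ n"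
    by (intro arg_cong2[of _ _ _ _ "(/)"] sum.cong refl) (simp only: kernel, simp)
  also have "\<dots> = f \<epsilon>" using assms finite_cube by simp
  finally show ?thesis .
qed

section \<open>Hypercontractivity for complex noise\<close>

text \<open>
  Minkowski's inequality in \<open>L\<^sub>3\<close>, with upper bounds \<open>s\<close> and \<open>t\<close> in place of the norms and
  \<open>M\<close> as total mass, so that no cube roots appear. It follows by writing \<open>f + g\<close> as a convex
  combination of \<open>f / s\<close> and \<open>g / t\<close>, up to the factor \<open>s + t\<close>, and using that cubing is convex.
\<close>

lemma L3_triangle:
  fixes f g :: "'a \<Rightarrow> real"
  assumes S: "finite S" and f: "\<And>i. i \<in> S \<Longrightarrow> 0 \<le> f i" and g: "\<And>i. i \<in> S \<Longrightarrow> 0 \<le> g i"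
    and s: "0 \<le> s" "(\<Sum>i\<in>S. f i ^ 3) \<le> M * s ^ 3" and t: "0 \<le> t" "(\<Sum>i\<in>S. g i ^ 3) \<le> M * t ^ 3"
  shows "(\<Sum>i\<in>S. (f i + g i) ^ 3) \<le> M * (s + t) ^ 3"
proof (cases "s = 0 \<or> t = 0")
  case True
  have vanish: "h i = 0" if "(\<Sum>i\<in>S. h i ^ 3) \<le> M * 0 ^ 3" "\<And>i. i \<in> S \<Longrightarrow> 0 \<le> h i" "i \<in> S" for h :: "'a \<Rightarrow> real" and i
  proof -
    have "(\<Sum>i\<in>S. h i ^ 3) = 0"
      using that by (intro antisym sum_nonneg) auto
    then show ?thesis using that S by (simp add: sum_nonneg_eq_0_iff)
  qed
  from True show ?thesis
  proof
    assume "s = 0"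
    then show ?thesis using vanish[of f] s f t by simp
  next
    assume "t = 0"
    then show ?thesis using vanish[of g] t g s by simp
  qed
next
  case False
  then have pos: "0 < s" "0 < t" using s t by auto
  have "(f i + g i) ^ 3 \<le> (s + t)\<^sup>2 * (f i ^ 3 / s\<^sup>2 + g i ^ 3 / t\<^sup>2)" if i: "i \<in> S" for i
  proof -
    define x y where "x = f i / s" and "y = g i / t"
    have xy: "0 \<le> x" "0 \<le> y" "f i = s * x" "g i = t * y"
      using pos f g i by (auto simp: x_def y_def)
    (* Convexity of the cube as an explicit nonnegative remainder. *)
    have "0 \<le> s * t * (x - y)\<^sup>2 * ((2 * s + t) * x + (s + 2 * t) * y)"
      using pos xy by (intro mult_nonneg_nonneg add_nonneg_nonneg) auto
    also have "\<dots> = (s + t)\<^sup>2 * (s * x ^ 3 + t * y ^ 3) - (s * x + t * y) ^ 3"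
      by algebra
    finally show ?thesis using pos unfolding xy(3,4)
      by (simp add: power2_eq_square power3_eq_cube mult_ac)
  qed
  then have "(\<Sum>i\<in>S. (f i + g i) ^ 3) \<le> (\<Sum>i\<in>S. (s + t)\<^sup>2 * (f i ^ 3 / s\<^sup>2 + g i ^ 3 / t\<^sup>2))"
    by (rule sum_mono)
  also have "\<dots> = (s + t)\<^sup>2 * ((\<Sum>i\<in>S. f i ^ 3) / s\<^sup>2 + (\<Sum>i\<in>S. g i ^ 3) / t\<^sup>2)"
    by (simp add: sum.distrib sum_divide_distrib flip: sum_distrib_left)
  also have "\<dots> \<le> (s + t)\<^sup>2 * (M * s ^ 3 / s\<^sup>2 + M * t ^ 3 / t\<^sup>2)"
    using s t by (intro mult_left_mono add_mono divide_right_mono) auto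
  also have "\<dots> = M * (s + t) ^ 3"
    using pos by (simp add: power2_eq_square power3_eq_cube algebra_simps)
  finally show ?thesis .
qed

text \<open>
  The two-point inequality tensorises: in the new coordinate it is applied pointwise, the
  \<open>L\<^sub>3\<close> triangle inequality (\<open>3\<close> being the ratio of the exponents \<open>4\<close> and \<open>4/3\<close>)
  interchanges the two averages, and the induction hypothesis is applied to the restrictions
  \<open>cp\<close> and \<open>cm\<close> of the polynomial to the two values of that coordinate.
\<close>

lemma hypercontractive:
  assumes ell: "9 * (Re w)\<^sup>2 + 9 / 2 * (Im w)\<^sup>2 = 1"
  shows "(\<Sum>\<epsilon>\<in>cube n. cmod (walsh_poly n (noise w c) \<epsilon>) ^ 4) / 2 ^ n
    \<le> ((\<Sum>\<epsilon>\<in>cube n. cmod (walsh_poly n c \<epsilon>) powr (4/3)) / 2 ^ n) ^ 3"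
proof (induction n arbitrary: c)
  case 0
  show ?case by (simp add: cube_def walsh_poly_def noise_def powr_power_real walsh_def)
next
  case (Suc n)
  define N where "N c = (\<Sum>\<epsilon>\<in>cube n. cmod (walsh_poly n c \<epsilon>) powr (4/3)) / 2 ^ n" for c
  define Y where "Y = (\<Sum>\<epsilon>\<in>cube (Suc n). cmod (walsh_poly (Suc n) c \<epsilon>) powr (4/3)) / 2 ^ Suc n"
  define T where "T c = walsh_poly n (noise w c)" for c
  define c' where "c' = (\<lambda>A. c (insert (Suc n) A))"
  define cp cm where "cp = (\<lambda>A. c A + 1 * c' A)" and "cm = (\<lambda>A. c A + (-1) * c' A)"
  have T: "T cp \<epsilon> = T c \<epsilon> + T c' \<epsilon>" "T cm \<epsilon> = T c \<epsilon> - T c' \<epsilon>" for \<epsilon>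
    unfolding T_def cp_def cm_def walsh_poly_linear by simp_all
  have W: "walsh_poly n cp \<epsilon> = walsh_poly n c \<epsilon> + walsh_poly n c' \<epsilon>"
      "walsh_poly n cm \<epsilon> = walsh_poly n c \<epsilon> - walsh_poly n c' \<epsilon>" for \<epsilon>
    by (simp_all add: cp_def cm_def walsh_poly_def algebra_simps sum.distrib sum_subtractf)
  have cube3: "(x powr (4/3)) ^ 3 = x ^ 4" if "0 \<le> x" for x :: real
    using that by (simp add: powr_power_real)
  have IH: "(\<Sum>\<epsilon>\<in>cube n. (cmod (T c \<epsilon>) powr (4/3)) ^ 3) \<le> 2 ^ n * N c ^ 3" for c
    using Suc.IH[of c] by (simp add: T_def N_def cube3 field_simps)
  have "(\<Sum>\<epsilon>\<in>cube (Suc n). cmod (walsh_poly (Suc n) (noise w c) \<epsilon>) ^ 4)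
      = (\<Sum>\<epsilon>\<in>cube n. cmod (T c \<epsilon> + w * T c' \<epsilon>) ^ 4 + cmod (T c \<epsilon> - w * T c' \<epsilon>) ^ 4)"
    by (simp add: sum_cube_Suc walsh_poly_noise_Suc T_def c'_def)
  also have "\<dots> \<le> (\<Sum>\<epsilon>\<in>cube n. (cmod (T cp \<epsilon>) powr (4/3) + cmod (T cm \<epsilon>) powr (4/3)) ^ 3 / 4)"
  proof (rule sum_mono)
    fix \<epsilon>
    show "cmod (T c \<epsilon> + w * T c' \<epsilon>) ^ 4 + cmod (T c \<epsilon> - w * T c' \<epsilon>) ^ 4
      \<le> (cmod (T cp \<epsilon>) powr (4/3) + cmod (T cm \<epsilon>) powr (4/3)) ^ 3 / 4"
      using two_point[OF ell, of "T c \<epsilon>" "T c' \<epsilon>"] by (simp add: T power_divide)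
  qed
  also have "\<dots> \<le> 2 ^ n * (N cp + N cm) ^ 3 / 4"
    unfolding sum_divide_distrib[symmetric]
    by (intro divide_right_mono L3_triangle IH finite_cube) (auto simp: N_def intro!: sum_nonneg divide_nonneg_nonneg)
  also have "N cp + N cm = 2 * Y"
    unfolding Y_def N_def sum_cube_Suc walsh_poly_Suc by (simp add: W c'_def sum.distrib add_divide_distrib)
  also have "2 ^ n * (2 * Y) ^ 3 / 4 = Y ^ 3 * 2 ^ Suc n"
    by (simp add: power_mult_distrib)
  finally have "(\<Sum>\<epsilon>\<in>cube (Suc n). cmod (walsh_poly (Suc n) (noise w c) \<epsilon>) ^ 4) / 2 ^ Suc n \<le> Y ^ 3"
    by (subst pos_divide_le_eq) auto
  then show ?case unfolding Y_def .
qed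

section \<open>Hoelder's inequality\<close>

lemma Hoelder_sum:
  fixes f g :: "'a \<Rightarrow> real"
  assumes S: "finite S" and f: "\<And>i. i \<in> S \<Longrightarrow> 0 \<le> f i" and g: "\<And>i. i \<in> S \<Longrightarrow> 0 \<le> g i"
    and \<theta>: "0 < \<theta>" "\<theta> < 1"
  shows "(\<Sum>i\<in>S. f i powr \<theta> * g i powr (1 - \<theta>)) \<le> (\<Sum>i\<in>S. f i) powr \<theta> * (\<Sum>i\<in>S. g i) powr (1 - \<theta>)"
proof -
  define F G where "F = (\<Sum>i\<in>S. f i)" and "G = (\<Sum>i\<in>S. g i)"
  have FG: "0 \<le> F" "0 \<le> G" using f g by (auto simp: F_def G_def intro: sum_nonneg)
  show ?thesis
  proof (cases "F = 0 \<or> G = 0")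
    case True
    then have "f i powr \<theta> * g i powr (1 - \<theta>) = 0" if "i \<in> S" for i
      using that S f g by (auto simp: F_def G_def sum_nonneg_eq_0_iff)
    then show ?thesis by (simp add: sum.neutral)
  next
    case False
    with FG have pos: "0 < F" "0 < G" by auto
    have "f i powr \<theta> * g i powr (1 - \<theta>) \<le> F powr \<theta> * G powr (1 - \<theta>) * (\<theta> * (f i / F) + (1 - \<theta>) * (g i / G))"
      if i: "i \<in> S" for i
    proof (cases "f i = 0 \<or> g i = 0")
      case True
      then show ?thesis using f[OF i] g[OF i] pos \<theta> by auto
    next
      case False
      then have fg: "f i > 0" "g i > 0" using f[OF i] g[OF i] by auto
      have "(f i / F) powr \<theta> * (g i / G) powr (1 - \<theta>) \<le> \<theta> * (f i / F) + (1 - \<theta>) * (g i / G)"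
        using \<theta> pos fg by (intro Youngs_inequality_0) auto
      then show ?thesis using pos fg by (simp add: powr_divide field_simps)
    qed
    then have "(\<Sum>i\<in>S. f i powr \<theta> * g i powr (1 - \<theta>))
      \<le> (\<Sum>i\<in>S. F powr \<theta> * G powr (1 - \<theta>) * (\<theta> * (f i / F) + (1 - \<theta>) * (g i / G)))"
      by (rule sum_mono)
    also have "\<dots> = F powr \<theta> * G powr (1 - \<theta>) * (\<theta> * (F / F) + (1 - \<theta>) * (G / G))"
      by (simp add: F_def G_def sum.distrib flip: sum_distrib_left sum_divide_distrib)
    also have "\<dots> = F powr \<theta> * G powr (1 - \<theta>)" using pos by simp
    finally show ?thesis by (simp add: F_def G_def)
  qed
qed

lemma Hoelder_cube:
  fixes f g :: "(nat \<Rightarrow> real) \<Rightarrow> real" and \<theta> :: real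
  assumes f: "\<And>\<epsilon>. 0 \<le> f \<epsilon>" and g: "\<And>\<epsilon>. 0 \<le> g \<epsilon>" and \<theta>: "0 < \<theta>" "\<theta> < 1"
  shows "(\<Sum>\<epsilon>\<in>cube n. f \<epsilon> powr \<theta> * g \<epsilon> powr (1 - \<theta>)) / 2 ^ n
     \<le> ((\<Sum>\<epsilon>\<in>cube n. f \<epsilon>) / 2 ^ n) powr \<theta> * ((\<Sum>\<epsilon>\<in>cube n. g \<epsilon>) / 2 ^ n) powr (1 - \<theta>)"
proof -
  have "((2::real) ^ n) powr \<theta> * (2 ^ n) powr (1 - \<theta>) = 2 ^ n"
    by (simp flip: powr_add)
  then show ?thesis
    using Hoelder_sum[OF finite_cube[of n] f g \<theta>]
    by (simp add: powr_divide f g sum_nonneg divide_right_mono)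
qed

section \<open>Extrapolation from the ellipse to the point 1\<close>

text \<open>
  The value of \<open>\<kappa>\<close> is the exponential, at the point \<open>1\<close>, of the Green function with pole at
  infinity of the exterior of the ellipse. The map \<open>r \<mapsto> (1/r - r) / 6\<close> carries the
  circle of radius \<open>\<surd>2 - 1\<close> to the ellipse and the point \<open>\<surd>10 - 3\<close> to \<open>1\<close>. Numerically,
  \<open>\<kappa>\<close> is about \<open>2.5525\<close>.
\<close>

definition \<kappa> :: real where "\<kappa> = (sqrt 2 - 1) / (sqrt 10 - 3)"

text \<open>
  Because \<open>1 / (\<surd>2 - 1)\<^sup>2 = 3 + 2 \<surd>2\<close>, the map sends \<open>r\<close> on the circle to a fixed real
  multiple of \<open>Re r\<close> plus a fixed imaginary multiple of \<open>Im r\<close>.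
\<close>

lemma ellipse_param:
  assumes r: "cmod r = sqrt 2 - 1"
  defines "w \<equiv> (1 - r\<^sup>2) / (6 * r)"
  shows "9 * (Re w)\<^sup>2 + 9 / 2 * (Im w)\<^sup>2 = 1"
proof -
  define s where "s = sqrt 2"
  have s: "s\<^sup>2 = 2" by (simp add: s_def)
  have "r \<noteq> 0" using r real_sqrt_gt_1_iff[of 2] by force
  have r2: "(Re r)\<^sup>2 + (Im r)\<^sup>2 = 3 - 2 * s"
    unfolding cmod_power2[symmetric] r s_def by (simp add: power2_eq_square algebra_simps)
  have unit: "(3 - 2 * s) * (3 + 2 * s) = 1" using s by (simp add: power2_eq_square algebra_simps)
  have "r * cnj r = of_real (3 - 2 * s)"
    using r2 by (simp add: complex_mult_cnj del: of_real_diff of_real_mult)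
  then have "r * (of_real (3 + 2 * s) * cnj r) = of_real (3 - 2 * s) * of_real (3 + 2 * s)"
    by (metis mult.assoc mult.commute)
  also have "\<dots> = 1" by (simp only: unit of_real_1 flip: of_real_mult)
  finally have "1 / r = of_real (3 + 2 * s) * cnj r"
    using \<open>r \<noteq> 0\<close> by (metis nonzero_mult_div_cancel_left)
  moreover have "w = (1 / r - r) / 6"
    using \<open>r \<noteq> 0\<close> by (simp add: w_def field_simps power2_eq_square)
  ultimately have w: "w = (of_real (3 + 2 * s) * cnj r - r) / 6" by simp
  have ReIm: "Re w = (1 + s) / 3 * Re r" "Im w = - (2 + s) / 3 * Im r"
    unfolding w by (simp_all add: field_simps)
  have "9 * (Re w)\<^sup>2 + 9 / 2 * (Im w)\<^sup>2 = (1 + s)\<^sup>2 * (Re r)\<^sup>2 + (2 + s)\<^sup>2 / 2 * (Im r)\<^sup>2"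
    unfolding ReIm by (simp add: power2_eq_square field_simps)
  also have "\<dots> = (3 + 2 * s) * ((Re r)\<^sup>2 + (Im r)\<^sup>2)"
  proof -
    have sq: "(1 + s)\<^sup>2 = 3 + 2 * s" "(2 + s)\<^sup>2 / 2 = 3 + 2 * s"
      using s by (simp_all add: power2_eq_square algebra_simps)
    show ?thesis unfolding sq by (simp add: algebra_simps)
  qed
  finally show ?thesis using unit r2 by (simp add: mult.commute)
qed

lemma kappa_nonneg: "0 \<le> \<kappa>" and kappa_le: "\<kappa> \<le> 2.69076"
proof -
  have "sqrt 2 \<le> 1.415" by (rule real_le_lsqrt) (auto simp: power2_eq_square)
  moreover have "1 \<le> sqrt 2" by simp
  moreover have "3.162 \<le> sqrt 10" by (rule real_le_rsqrt) (simp add: power2_eq_square)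
  ultimately show "0 \<le> \<kappa>" "\<kappa> \<le> 2.69076" by (simp_all add: \<kappa>_def divide_le_eq)
qed

text \<open>
  A Bernstein--Walsh inequality. Multiplied by \<open>r\<^sup>d\<close>, a polynomial of degree at most \<open>d\<close> in
  \<open>w = (1/r - r) / 6\<close> is a polynomial in \<open>r\<close>, so the maximum principle on the disc bounds
  its value at \<open>r = \<surd>10 - 3\<close>, that is, at \<open>w = 1\<close>.
\<close>

lemma ellipse_extrapolation:
  assumes deg: "\<And>A. A \<subseteq> {1..n} \<Longrightarrow> d < card A \<Longrightarrow> c A = 0"
    and bound: "\<And>w. 9 * (Re w)\<^sup>2 + 9 / 2 * (Im w)\<^sup>2 = 1 \<Longrightarrow> cmod (\<Sum>A\<in>Pow {1..n}. w ^ card A * c A) \<le> B"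
  shows "cmod (\<Sum>A\<in>Pow {1..n}. c A) \<le> \<kappa> ^ d * B"
proof -
  define R r0 where "R = sqrt 2 - 1" and "r0 = sqrt 10 - 3"
  define P where "P w = (\<Sum>A\<in>Pow {1..n}. w ^ card A * c A)" for w
  define \<Phi> where "\<Phi> r = (\<Sum>A\<in>Pow {1..n}. ((1 - r\<^sup>2) / 6) ^ card A * r ^ (d - card A) * c A)" for r
  have \<Phi>: "\<Phi> r = r ^ d * P ((1 - r\<^sup>2) / (6 * r))" if "r \<noteq> 0" for r
    unfolding \<Phi>_def P_def sum_distrib_left
  proof (rule sum.cong[OF refl])
    fix A assume A: "A \<in> Pow {1..n}"
    show "((1 - r\<^sup>2) / 6) ^ card A * r ^ (d - card A) * c A = r ^ d * (((1 - r\<^sup>2) / (6 * r)) ^ card A * c A)"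
    proof (cases "card A \<le> d")
      case True
      then show ?thesis using that
        by (simp add: power_diff power_divide power_mult_distrib)
    next
      case False
      then show ?thesis using deg A by simp
    qed
  qed
  have "(3::real) < sqrt 10" by (rule real_less_rsqrt) simp
  moreover have "sqrt 10 \<le> 3.2" by (rule real_le_lsqrt) (auto simp: power2_eq_square)
  moreover have "1.4 \<le> sqrt 2" by (rule real_le_rsqrt) (auto simp: power2_eq_square)
  ultimately have r0: "0 < r0" "r0 \<le> R" and R: "0 < R" by (auto simp: r0_def R_def)
  have "cmod (\<Phi> (of_real r0)) \<le> R ^ d * B"
  proof (rule maximum_modulus_frontier[where f = \<Phi> and \<xi> = "of_real r0" and S = "cball 0 R"])
    show "\<Phi> holomorphic_on interior (cball 0 R)"
      unfolding \<Phi>_def by (intro holomorphic_intros) auto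
    show "continuous_on (closure (cball 0 R)) \<Phi>"
      unfolding \<Phi>_def by (intro continuous_intros) auto
    fix r :: complex assume "r \<in> frontier (cball 0 R)"
    then have r: "cmod r = R" using R by simp
    then have "r \<noteq> 0" using R by auto
    then have "cmod (\<Phi> r) = R ^ d * cmod (P ((1 - r\<^sup>2) / (6 * r)))"
      by (simp add: \<Phi> norm_mult norm_power r)
    also have "\<dots> \<le> R ^ d * B"
      unfolding P_def using R r by (intro mult_left_mono bound ellipse_param) (auto simp: R_def)
    finally show "cmod (\<Phi> r) \<le> R ^ d * B" .
  qed (use r0 in auto)
  moreover have "(1 - (of_real r0 :: complex)\<^sup>2) / (6 * of_real r0) = 1"
  proof -
    have "1 - r0\<^sup>2 = 6 * r0" by (simp add: r0_def power2_eq_square algebra_simps)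
    then have "of_real (1 - r0\<^sup>2) = (of_real (6 * r0) :: complex)" by simp
    then show ?thesis using r0 by simp
  qed
  ultimately have "r0 ^ d * cmod (P 1) \<le> R ^ d * B"
    using r0 \<Phi>[of "of_real r0"] by (simp add: norm_mult norm_power)
  then show ?thesis
    using r0 by (simp add: P_def \<kappa>_def R_def r0_def power_divide field_simps)
qed

section \<open>Comparison of moments\<close>

text \<open>
  Reverse Hoelder between the exponents \<open>4\<close> and \<open>4/3\<close>. The pairing of the noisy polynomial
  with \<open>g\<close>, the function dual to \<open>F\<close> in \<open>L\<^sub>4\<close>, is a scalar polynomial in \<open>w\<close>. Hypercontractivity
  bounds it on the ellipse, and at \<open>w = 1\<close> it is the fourth moment itself.
\<close>

lemma L4_le_L43:
  assumes deg: "\<And>A. A \<subseteq> {1..n} \<Longrightarrow> d < card A \<Longrightarrow> c A = 0"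
  defines "F \<equiv> walsh_poly n c"
  shows "(\<Sum>\<epsilon>\<in>cube n. cmod (F \<epsilon>) ^ 4) / 2 ^ n
    \<le> (\<kappa> ^ d) ^ 4 * ((\<Sum>\<epsilon>\<in>cube n. cmod (F \<epsilon>) powr (4/3)) / 2 ^ n) ^ 3"
proof -
  define s4 where "s4 = (\<Sum>\<epsilon>\<in>cube n. cmod (F \<epsilon>) ^ 4) / 2 ^ n"
  define s43 where "s43 = (\<Sum>\<epsilon>\<in>cube n. cmod (F \<epsilon>) powr (4/3)) / 2 ^ n"
  have nonneg: "0 \<le> s4" "0 \<le> s43" by (auto simp: s4_def s43_def intro!: sum_nonneg divide_nonneg_nonneg)
  define g where "g \<epsilon> = cnj (F \<epsilon>) * of_real ((cmod (F \<epsilon>))\<^sup>2)" for \<epsilon>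
  define b where "b A = (\<Sum>\<epsilon>\<in>cube n. of_real (walsh A \<epsilon>) * g \<epsilon>) / 2 ^ n" for A
  have pairing: "(\<Sum>A\<in>Pow {1..n}. w ^ card A * (c A * b A))
      = (\<Sum>\<epsilon>\<in>cube n. walsh_poly n (noise w c) \<epsilon> * g \<epsilon>) / 2 ^ n" for w
    unfolding walsh_poly_def noise_def b_def sum_distrib_right sum_distrib_left sum_divide_distrib
    by (subst sum.swap) (simp add: mult_ac)
  have bound: "cmod (\<Sum>A\<in>Pow {1..n}. w ^ card A * (c A * b A)) \<le> s43 powr (3/4) * s4 powr (3/4)"
    if w: "9 * (Re w)\<^sup>2 + 9 / 2 * (Im w)\<^sup>2 = 1" for w
  proof -
    define T where "T = walsh_poly n (noise w c)"
    have "cmod (\<Sum>A\<in>Pow {1..n}. w ^ card A * (c A * b A)) \<le> (\<Sum>\<epsilon>\<in>cube n. cmod (T \<epsilon> * g \<epsilon>)) / 2 ^ n"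
      unfolding pairing T_def[symmetric] by (simp add: norm_divide norm_power divide_right_mono norm_sum)
    also have "\<dots> = (\<Sum>\<epsilon>\<in>cube n. (cmod (T \<epsilon>) ^ 4) powr (1/4) * (cmod (F \<epsilon>) ^ 4) powr (1 - 1/4)) / 2 ^ n"
      by (simp add: power_powr_real norm_mult g_def power2_eq_square power3_eq_cube mult_ac)
    also have "\<dots> \<le> ((\<Sum>\<epsilon>\<in>cube n. cmod (T \<epsilon>) ^ 4) / 2 ^ n) powr (1/4) * s4 powr (1 - 1/4)"
      unfolding s4_def by (rule Hoelder_cube) auto
    also have "\<dots> \<le> (s43 ^ 3) powr (1/4) * s4 powr (1 - 1/4)"
      using hypercontractive[OF w, of n c] unfolding T_def s43_def F_def
      by (intro mult_right_mono powr_mono2) (auto intro!: sum_nonneg divide_nonneg_nonneg)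
    also have "\<dots> = s43 powr (3/4) * s4 powr (3/4)"
      using nonneg by (simp add: power_powr_real)
    finally show ?thesis .
  qed
  have "cmod (\<Sum>A\<in>Pow {1..n}. c A * b A) \<le> \<kappa> ^ d * (s43 powr (3/4) * s4 powr (3/4))"
    using bound deg by (intro ellipse_extrapolation) auto
  also have "(\<Sum>A\<in>Pow {1..n}. c A * b A) = of_real s4"
  proof -
    have "F \<epsilon> * g \<epsilon> = of_real (cmod (F \<epsilon>) ^ 4)" for \<epsilon>
    proof -
      have "F \<epsilon> * g \<epsilon> = (F \<epsilon> * cnj (F \<epsilon>)) * of_real ((cmod (F \<epsilon>))\<^sup>2)" by (simp add: g_def)
      also have "\<dots> = of_real ((cmod (F \<epsilon>))\<^sup>2 * (cmod (F \<epsilon>))\<^sup>2)"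
        by (simp only: complex_norm_square[symmetric] of_real_mult)
      finally show ?thesis by (simp flip: power_add)
    qed
    then show ?thesis
      using pairing[of 1] by (simp add: noise_def F_def s4_def walsh_poly_def)
  qed
  finally have main: "s4 \<le> \<kappa> ^ d * (s43 powr (3/4) * s4 powr (3/4))" using nonneg by simp
  have "s4 \<le> (\<kappa> ^ d) ^ 4 * s43 ^ 3"
  proof (cases "s4 = 0")
    case True
    then show ?thesis using kappa_nonneg nonneg by simp
  next
    case False
    have "s4 ^ 4 \<le> (\<kappa> ^ d * (s43 powr (3/4) * s4 powr (3/4))) ^ 4"
      by (rule power_mono[OF main nonneg(1)])
    also have "\<dots> = (\<kappa> ^ d) ^ 4 * s43 ^ 3 * s4 ^ 3"
      using nonneg by (simp add: power_mult_distrib powr_power_real mult.assoc)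
    finally show ?thesis using False nonneg by (simp add: eval_nat_numeral)
  qed
  then show ?thesis by (simp add: s4_def s43_def)
qed

text \<open>
  It remains to pass from the exponents \<open>4\<close> and \<open>4/3\<close> to \<open>2\<close> and \<open>1\<close>. Both \<open>N 2\<close> and
  \<open>N (4/3)\<close> are bounded by interpolation between \<open>N 4\<close> and \<open>N 1\<close>, and since
  \<open>1/(4/3) - 1/4 = 1 - 1/2\<close>, the loss of \<open>\<kappa>\<^sup>d\<close> is the same for both pairs of norms.
\<close>

theorem theorem13:
  fixes n d :: nat and f :: "(nat \<Rightarrow> real) \<Rightarrow> complex"
  assumes "n \<ge> 1"
    and "d \<in> {1..n}"
    and "degree_at_most n f d"
  shows "Lp_norm n 2 f \<le> 2.69076 ^ d * Lp_norm n 1 f"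
proof -
  define N where "N p = (\<Sum>\<epsilon>\<in>cube n. cmod (f \<epsilon>) powr p) / 2 ^ n" for p
  have N: "0 \<le> N p" for p by (auto simp: N_def intro!: sum_nonneg divide_nonneg_nonneg)
  have "walsh_poly n (fourier_coeff n f) \<epsilon> = f \<epsilon>" if "\<epsilon> \<in> cube n" for \<epsilon>
    using that by (rule fourier_inversion)
  then have N4: "N 4 \<le> (\<kappa> ^ d) ^ 4 * N (4/3) ^ 3"
    using L4_le_L43[of n d "fourier_coeff n f"] assms(3)
    by (simp add: N_def degree_at_most_def)
  have interpolation: "N (4 * \<theta> + (1 - \<theta>)) \<le> N 4 powr \<theta> * N 1 powr (1 - \<theta>)" if "0 < \<theta>" "\<theta> < 1" for \<theta>
    using Hoelder_cube[OF _ _ that, of "\<lambda>\<epsilon>. cmod (f \<epsilon>) powr 4" "\<lambda>\<epsilon>. cmod (f \<epsilon>) powr 1" n]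
    unfolding N_def by (simp only: powr_powr powr_ge_zero powr_add mult_1_left)
  (* Cube roots of the moments turn all exponents below into integers. *)
  define a b where "a = N 4 powr (1/3)" and "b = N 1 powr (1/3)"
  have ab: "0 \<le> a" "0 \<le> b" by (auto simp: a_def b_def)
  have a3: "a ^ 3 = N 4" and b3: "b ^ 3 = N 1"
    using N by (simp_all add: a_def b_def powr_power_real)
  have "N (4/3) ^ 3 \<le> (N 4 powr (1/9) * N 1 powr (8/9)) ^ 3"
    using interpolation[of "1/9"] N by (intro power_mono) auto
  also have "\<dots> = a * b ^ 8"
    using N by (simp add: power_mult_distrib powr_power_real a_def b_def)
  finally have N43: "N (4/3) ^ 3 \<le> a * b ^ 8" .
  have N2: "N 2 \<le> a * b\<^sup>2"
    using interpolation[of "1/3"] N by (simp add: a_def b_def powr_power_real)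
  define K where "K = \<kappa> ^ d"
  have K: "0 \<le> K" using kappa_nonneg by (simp add: K_def)
  have a: "a \<le> K\<^sup>2 * b ^ 4"
  proof (cases "a = 0")
    case True
    then show ?thesis using K ab by simp
  next
    case False
    then have "0 < a" using ab by simp
    have "a * a\<^sup>2 = a ^ 3" by (simp add: power2_eq_square power3_eq_cube)
    also have "\<dots> \<le> K ^ 4 * (a * b ^ 8)"
      using N4 mult_left_mono[OF N43, of "K ^ 4"] K by (simp add: K_def a3)
    also have "\<dots> = a * (K\<^sup>2 * b ^ 4)\<^sup>2" by (simp add: power_mult_distrib)
    finally have "a\<^sup>2 \<le> (K\<^sup>2 * b ^ 4)\<^sup>2"
      using \<open>0 < a\<close> by (rule mult_left_le_imp_le)
    moreover have "0 \<le> K\<^sup>2 * b ^ 4" using K ab by simp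
    ultimately show ?thesis by (rule power2_le_imp_le)
  qed
  have "N 2 \<le> K\<^sup>2 * b ^ 4 * b\<^sup>2"
    using N2 mult_right_mono[OF a, of "b\<^sup>2"] by simp
  also have "\<dots> = (K * b ^ 3)\<^sup>2" by (simp add: power_mult_distrib flip: power_add)
  also have "\<dots> = (\<kappa> ^ d * N 1)\<^sup>2" by (simp add: K_def b3)
  finally have "sqrt (N 2) \<le> \<kappa> ^ d * N 1"
    using kappa_nonneg N by (simp add: real_le_lsqrt)
  also have "\<dots> \<le> 2.69076 ^ d * N 1"
    using kappa_nonneg kappa_le N by (intro mult_right_mono power_mono) auto
  finally show ?thesis
    using N by (simp add: Lp_norm_def N_def powr_half_sqrt sum_nonneg)
qed

end
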